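(* Let $K\subset\mathbb{R}^2$ be a compact body and let $\mu$ be a measure on $(K,\mathcal{B}(K))$ with $\mu(K)<\infty$ such that $\mu(\{(\alpha,\beta)\in K:\alpha=x\})=0=\mu(\{(\alpha,\beta)\in K:\beta=y\})$ for all $x,y\in\mathbb{R}$. Then for all $(x,y)\in\mathbb{R}^2$, $$\begin{aligned}F_{K,\mu}(x,y)&=x\big(\mu(\{K<_1x\})-\mu(\{x<_1K\})\big)-\int_K\alpha\big(\mathbf{1}_{\{\alpha<x\}}-\mathbf{1}_{\{x<\alpha\}}\big)\,\mu(d\alpha,d\beta)\\&\quad+y\big(\mu(\{K<_2y\})-\mu(\{y<_2K\})\big)-\int_K\beta\big(\mathbf{1}_{\{\beta<y\}}-\mathbf{1}_{\{y<\beta\}}\big)\,\mu(d\alpha,d\beta).\end{aligned}$$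
   Context: A compact body in $\mathbb{R}^2$ is a non-empty compact set that coincides with the closure of its interior. $\mathcal{B}(K)$ is the Borel $\sigma$-algebra on $K$. Notation: $\{K<_1x\}:=\{(\alpha,\beta)\in K:\alpha<x\}$, $\{x<_1K\}:=\{(\alpha,\beta)\in K:x<\alpha\}$, $\{K<_2y\}:=\{(\alpha,\beta)\in K:\beta<y\}$, $\{y<_2K\}:=\{(\alpha,\beta)\in K:y<\beta\}$. The generalized conic function associated with $K$ and $\mu$ is $$F_{K,\mu}(x,y):=\int_K\big(|x-\alpha|+|y-\beta|\big)\,\mu(d\alpha,d\beta),\qquad (x,y)\in\mathbb{R}^2.$$ *)

theory Defs
  imports "HOL-Analysis.Analysis"
begin

definition compact_body :: "(real \<times> real) set \<Rightarrow> bool" where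
  "compact_body K \<longleftrightarrow> K \<noteq> {} \<and> compact K \<and> K = closure (interior K)"

definition below1 :: "(real \<times> real) set \<Rightarrow> real \<Rightarrow> (real \<times> real) set" where
  "below1 K x = {(\<alpha>, \<beta>) \<in> K. \<alpha> < x}"

definition above1 :: "real \<Rightarrow> (real \<times> real) set \<Rightarrow> (real \<times> real) set" where
  "above1 x K = {(\<alpha>, \<beta>) \<in> K. x < \<alpha>}"

definition below2 :: "(real \<times> real) set \<Rightarrow> real \<Rightarrow> (real \<times> real) set" where
  "below2 K y = {(\<alpha>, \<beta>) \<in> K. \<beta> < y}"

definition above2 :: "real \<Rightarrow> (real \<times> real) set \<Rightarrow> (real \<times> real) set" where
  "above2 y K = {(\<alpha>, \<beta>) \<in> K. y < \<beta>}"

text \<open>The measure is meant to live on \<open>(K, \<B>(K))\<close>, i.e. its \<open>\<sigma>\<close>-algebra is that of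
  \<open>restrict_space borel K\<close>, so its space is \<open>K\<close> itself.\<close>

definition conic_function ::
    "(real \<times> real) set \<Rightarrow> (real \<times> real) measure \<Rightarrow> real \<Rightarrow> real \<Rightarrow> real" where
  "conic_function K \<mu> x y = (LINT p:K|\<mu>. \<bar>x - fst p\<bar> + \<bar>y - snd p\<bar>)"

end

theory Submission
  imports Defs
begin

text \<open>
  The formula rests on the pointwise identity
  \<open>\<bar>x - \<alpha>\<bar> = (x - \<alpha>) * (1{\<alpha> < x} - 1{x < \<alpha>})\<close>,
  that is, \<open>\<bar>t\<bar> = t * sgn t\<close> with the sign written as a difference of indicators.
  Expanding the product and integrating, the part with the constant factor \<open>x\<close> gives a
  difference of measures and the part with \<open>\<alpha>\<close> is the integral in the formula.  Splitting
  the integral in this way needs both parts to be integrable: the measure is finite, and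
  the coordinates are bounded on the compact set \<open>K\<close>.  The two coordinates are treated
  separately, by one and the same statement about an integrable function \<open>f\<close>
  (lemma \<open>integral_abs_diff_eq\<close>).
\<close>

text \<open>Expansion of \<open>\<bar>x - f\<bar> = (x - f) * sgn (x - f)\<close>.  The product with the sign stays
  integrable because the sign is measurable and bounded by 1.\<close>

lemma (in finite_measure) integral_abs_diff_eq:
  fixes f :: "'a \<Rightarrow> real"
  assumes f: "integrable M f"
  shows "(LINT p|M. \<bar>x - f p\<bar>) =
      x * (measure M {p \<in> space M. f p < x} - measure M {p \<in> space M. x < f p})
      - (LINT p|M. f p * (indicator {p. f p < x} p - indicator {p. x < f p} p))"
proof -
  define s :: "'a \<Rightarrow> real"
    where "s = (\<lambda>p. indicator {p. f p < x} p - indicator {p. x < f p} p)"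
  let ?L = "{p \<in> space M. f p < x}" and ?R = "{p \<in> space M. x < f p}"
  have [measurable]: "f \<in> borel_measurable M"
    using f by (rule borel_measurable_integrable)
  have s_eq: "s p = indicator ?L p - indicator ?R p" if "p \<in> space M" for p
    using that by (simp add: s_def indicator_def)
  have int_ind: "integrable M (indicator ?L :: 'a \<Rightarrow> real)"
      "integrable M (indicator ?R :: 'a \<Rightarrow> real)"
    by (auto intro!: integrable_real_indicator simp: emeasure_finite less_top[symmetric])
  then have int_s: "integrable M s"
    by (subst Bochner_Integration.integrable_cong[OF refl s_eq]) auto
  have int_fs: "integrable M (\<lambda>p. f p * s p)"
    using int_s
    by (intro Bochner_Integration.integrable_bound[OF f] AE_I2)
       (auto simp: s_def indicator_def)
  have "(LINT p|M. \<bar>x - f p\<bar>) = (LINT p|M. x * s p - f p * s p)"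
    by (rule Bochner_Integration.integral_cong)
       (auto simp: s_def indicator_def)
  also have "\<dots> = x * (LINT p|M. s p) - (LINT p|M. f p * s p)"
    using int_s int_fs by simp
  also have "(LINT p|M. s p) = measure M ?L - measure M ?R"
  proof -
    have "(LINT p|M. s p) = (LINT p|M. indicator ?L p - indicator ?R p)"
      by (rule Bochner_Integration.integral_cong[OF refl s_eq])
    also have "\<dots> = measure M ?L - measure M ?R"
      using int_ind by (simp add: Int_absorb1 subset_iff)
    finally show ?thesis .
  qed
  finally show ?thesis
    by (simp add: s_def)
qed

lemma set_integral_space_eq:
  fixes f :: "'a \<Rightarrow> real"
  assumes "space M = A"
  shows "(LINT p:A|M. f p) = (LINT p|M. f p)"
  unfolding set_lebesgue_integral_def using assms
  by (intro Bochner_Integration.integral_cong) auto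

lemma integrable_continuous_on_compact_space:
  fixes f :: "'a::topological_space \<Rightarrow> real"
  assumes "compact K" "finite_measure \<mu>" "sets \<mu> = sets (restrict_space borel K)"
    and f: "continuous_on UNIV f"
  shows "integrable \<mu> f"
proof -
  interpret finite_measure \<mu> by fact
  have space: "space \<mu> = K"
    using sets_eq_imp_space_eq[OF assms(3)] by (simp add: space_restrict_space)
  have "f \<in> borel_measurable (restrict_space borel K)"
    using f by (intro measurable_restrict_space1 borel_measurable_continuous_onI)
  then have meas: "f \<in> borel_measurable \<mu>"
    using measurable_cong_sets[OF assms(3) refl] by blast
  have "compact (f ` K)"
    using assms(1) f by (intro compact_continuous_image continuous_on_subset[OF f]) auto
  then obtain B where "\<And>p. p \<in> K \<Longrightarrow> norm (f p) \<le> B"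
    by (meson bounded_iff compact_imp_bounded imageI)
  with meas space show ?thesis
    by (intro integrable_const_bound[where B = B] AE_I2) auto
qed

theorem lemma2p1:
  fixes K :: "(real \<times> real) set" and \<mu> :: "(real \<times> real) measure"
  assumes "compact_body K"
    and "sets \<mu> = sets (restrict_space borel K)"
    and "emeasure \<mu> K < \<infinity>"
    and "\<And>x. emeasure \<mu> {(\<alpha>, \<beta>) \<in> K. \<alpha> = x} = 0"
    and "\<And>y. emeasure \<mu> {(\<alpha>, \<beta>) \<in> K. \<beta> = y} = 0"
  shows "\<forall>x y. conic_function K \<mu> x y =
      x * (measure \<mu> (below1 K x) - measure \<mu> (above1 x K))
      - (LINT p:K|\<mu>. fst p * (indicator {(\<alpha>, \<beta>). \<alpha> < x} p - indicator {(\<alpha>, \<beta>). x < \<alpha>} p))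
      + y * (measure \<mu> (below2 K y) - measure \<mu> (above2 y K))
      - (LINT p:K|\<mu>. snd p * (indicator {(\<alpha>, \<beta>). \<beta> < y} p - indicator {(\<alpha>, \<beta>). y < \<beta>} p))"
proof (intro allI)
  fix x y :: real
  have space: "space \<mu> = K"
    using sets_eq_imp_space_eq[OF assms(2)] by (simp add: space_restrict_space)
  interpret finite_measure \<mu>
    using assms(3) space by (intro finite_measureI) auto
  have "compact K"
    using assms(1) by (simp add: compact_body_def)
  note int = integrable_continuous_on_compact_space[OF this finite_measure_axioms assms(2)]
  have int_fst: "integrable \<mu> fst" and int_snd: "integrable \<mu> snd"
    by (intro int continuous_intros)+
  have "conic_function K \<mu> x y = (LINT p|\<mu>. \<bar>x - fst p\<bar> + \<bar>y - snd p\<bar>)"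
    by (simp add: conic_function_def set_integral_space_eq[OF space])
  also have "\<dots> = (LINT p|\<mu>. \<bar>x - fst p\<bar>) + (LINT p|\<mu>. \<bar>y - snd p\<bar>)"
    using int_fst int_snd by (intro Bochner_Integration.integral_add) auto
  finally show "conic_function K \<mu> x y =
      x * (measure \<mu> (below1 K x) - measure \<mu> (above1 x K))
      - (LINT p:K|\<mu>. fst p * (indicator {(\<alpha>, \<beta>). \<alpha> < x} p - indicator {(\<alpha>, \<beta>). x < \<alpha>} p))
      + y * (measure \<mu> (below2 K y) - measure \<mu> (above2 y K))
      - (LINT p:K|\<mu>. snd p * (indicator {(\<alpha>, \<beta>). \<beta> < y} p - indicator {(\<alpha>, \<beta>). y < \<beta>} p))"
    unfolding integral_abs_diff_eq[OF int_fst] integral_abs_diff_eq[OF int_snd]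
    by (simp add: set_integral_space_eq[OF space] space case_prod_beta'
        below1_def above1_def below2_def above2_def)
qed

end
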